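(* Let $M$ and $N$ be positroids on $[n]$ such that $M$ is a quotient of $N$ and $\operatorname{rk}(M)=\operatorname{rk}(N)-1$. Let $\sigma^{:}$ and $\pi^{:}$ be the decorated permutations of $M$ and $N$, and let $(J^{\sigma}_i)_{i\in[n]}$ and $(J^{\pi}_i)_{i\in[n]}$ be the Grassmann conecklaces of $M$ and $N$, respectively. Then $\sigma^{:}=\overrightarrow{\rho_A}(\pi^{:})$, where $A=[n]\setminus\bigcup_{i\in[n]}\left(J^{\pi}_i\setminus J^{\sigma}_i\right)$.
   Context: For $i\in[n]$ the cyclic order $<_i$ on $[n]$ is $i<_i i+1<_i\cdots<_i n<_i 1<_i\cdots<_i i-1$; for equal-size sets $A,B$, $A\leq_i B$ (Gale order) means the $t$-th smallest element of $A$ under $<_i$ is $\leq_i$ the $t$-th smallest element of $B$, for all $t$. A decorated permutation on $[n]$ is a pair $(\pi,\operatorname{col})$, $\pi$ a permutation of $[n]$, $\operatorname{col}:[n]\to\{0,1,-1\}$ with $\operatorname{col}(i)=0$ iff $\pi(i)\ne i$ (fixed points with $\operatorname{col}=1$ are loops, with $\operatorname{col}=-1$ coloops). Its Grassmann necklace is $I_i=\{j: j<_i\pi^{-1}(j)\text{ or }\operatorname{col}(j)=-1\}$, $i\in[n]$; its positroid is the matroid whose bases are the sets $B$ of size $|I_1|$ with $I_i\leq_i B$ for all $i$; each positroid has a unique decorated permutation. The Grassmann conecklace of a positroid is $J_i=$ the $\leq_i$-maximum basis; equivalently $J_i=\pi^{-1}(I_i)$. Cyclic shift: given a decorated permutation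 $(\pi,\operatorname{col}_\pi)$ and $A\subseteq[n]$, $\overrightarrow{\rho_A}(\pi^{:})=(\sigma,\operatorname{col}_\sigma)$ where: for $i\in A$, $\sigma(i)=\pi(i)$ and $\operatorname{col}_\sigma(i)=\operatorname{col}_\pi(i)$; for $i\notin A$, $\sigma(i)=\pi(j)$ where $j$ is the maximum element of $[n]\setminus A$ with respect to $<_i$, and $\operatorname{col}_\sigma(i)=1$ if $\sigma(i)=i$, else $0$. $M$ is a quotient of $N$ if every circuit of $N$ is a union of circuits of $M$. *)

theory Defs
  imports "HOL-Combinatorics.Permutations" "HOL-Library.FuncSet"
begin

section \<open>Matroids, given by their ground set and family of bases\<close>

definition matroid :: "'a set \<Rightarrow> 'a set set \<Rightarrow> bool" where
  "matroid E \<B> \<longleftrightarrow> finite E \<and> \<B> \<noteq> {} \<and> (\<forall>B\<in>\<B>. B \<subseteq> E) \<and>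
     (\<forall>A\<in>\<B>. \<forall>B\<in>\<B>. \<forall>x\<in>A - B. \<exists>y\<in>B - A. insert y (A - {x}) \<in> \<B>)"

definition indep :: "'a set set \<Rightarrow> 'a set \<Rightarrow> bool" where
  "indep \<B> X \<longleftrightarrow> (\<exists>B\<in>\<B>. X \<subseteq> B)"

definition rk :: "'a set set \<Rightarrow> nat" where
  "rk \<B> = Max (card ` {X. indep \<B> X})"

definition circuits :: "'a set \<Rightarrow> 'a set set \<Rightarrow> 'a set set" where
  "circuits E \<B> = {C. C \<subseteq> E \<and> \<not> indep \<B> C \<and> (\<forall>X. X \<subset> C \<longrightarrow> indep \<B> X)}"

definition quotient_of :: "'a set \<Rightarrow> 'a set set \<Rightarrow> 'a set set \<Rightarrow> bool" where
  "quotient_of E M N \<longleftrightarrow> (\<forall>C\<in>circuits E N. \<exists>\<C>\<subseteq>circuits E M. C = \<Union>\<C>)"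

section \<open>Cyclic orders and the Gale order\<close>

text \<open>For \<open>i\<close> and \<open>a\<close> in \<open>{1..n}\<close>, \<open>cyc_pos n i a\<close> is the number of elements strictly below
  \<open>a\<close> in the order \<open>i <\<^sub>i i+1 <\<^sub>i \<dots> <\<^sub>i n <\<^sub>i 1 <\<^sub>i \<dots> <\<^sub>i i-1\<close>.\<close>

definition cyc_pos :: "nat \<Rightarrow> nat \<Rightarrow> nat \<Rightarrow> nat" where
  "cyc_pos n i a = (a + n - i) mod n"

definition cyc_less :: "nat \<Rightarrow> nat \<Rightarrow> nat \<Rightarrow> nat \<Rightarrow> bool" where
  "cyc_less n i a b \<longleftrightarrow> cyc_pos n i a < cyc_pos n i b"

definition cyc_le :: "nat \<Rightarrow> nat \<Rightarrow> nat \<Rightarrow> nat \<Rightarrow> bool" where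
  "cyc_le n i a b \<longleftrightarrow> cyc_less n i a b \<or> a = b"

definition cyc_list :: "nat \<Rightarrow> nat \<Rightarrow> nat set \<Rightarrow> nat list" where
  "cyc_list n i A = sort_key (cyc_pos n i) (sorted_list_of_set A)"

definition gale_le :: "nat \<Rightarrow> nat \<Rightarrow> nat set \<Rightarrow> nat set \<Rightarrow> bool" where
  "gale_le n i A B \<longleftrightarrow> list_all2 (cyc_le n i) (cyc_list n i A) (cyc_list n i B)"

section \<open>Decorated permutations and positroids\<close>

text \<open>Outside \<open>{1..n}\<close> a decorated permutation has its permutation equal to the identity and its
  colouring equal to \<open>undefined\<close>, so that equality of the pairs is equality of the decorated
  permutations of \<open>{1..n}\<close>.\<close>

type_synonym decperm = "(nat \<Rightarrow> nat) \<times> (nat \<Rightarrow> int)"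

definition decorated_permutation :: "nat \<Rightarrow> decperm \<Rightarrow> bool" where
  "decorated_permutation n = (\<lambda>(\<pi>, col).
     \<pi> permutes {1..n} \<and> col \<in> {1..n} \<rightarrow>\<^sub>E {0, 1, -1} \<and>
     (\<forall>i\<in>{1..n}. col i = 0 \<longleftrightarrow> \<pi> i \<noteq> i))"

definition necklace :: "nat \<Rightarrow> decperm \<Rightarrow> nat \<Rightarrow> nat set" where
  "necklace n = (\<lambda>(\<pi>, col) i. {j\<in>{1..n}. cyc_less n i j (inv \<pi> j) \<or> col j = -1})"

definition positroid_bases :: "nat \<Rightarrow> decperm \<Rightarrow> nat set set" where
  "positroid_bases n d = {B. B \<subseteq> {1..n} \<and> card B = card (necklace n d 1) \<and>
     (\<forall>i\<in>{1..n}. gale_le n i (necklace n d i) B)}"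

definition decorated_permutation_of :: "nat \<Rightarrow> nat set set \<Rightarrow> decperm \<Rightarrow> bool" where
  "decorated_permutation_of n M d \<longleftrightarrow> decorated_permutation n d \<and> M = positroid_bases n d"

definition positroid :: "nat \<Rightarrow> nat set set \<Rightarrow> bool" where
  "positroid n M \<longleftrightarrow> matroid {1..n} M \<and> (\<exists>d. decorated_permutation_of n M d)"

definition conecklace :: "nat \<Rightarrow> nat set set \<Rightarrow> nat \<Rightarrow> nat set" where
  "conecklace n M i = (THE J. J \<in> M \<and> (\<forall>B\<in>M. gale_le n i B J))"

section \<open>The cyclic shift\<close>

definition cyclic_shift :: "nat \<Rightarrow> nat set \<Rightarrow> decperm \<Rightarrow> decperm" where
  "cyclic_shift n A = (\<lambda>(\<pi>, col).
     let \<sigma> = (\<lambda>i. if i \<in> {1..n} - A then \<pi> (arg_max_on (cyc_pos n i) ({1..n} - A)) else \<pi> i)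
     in (\<sigma>, \<lambda>i\<in>{1..n}. if i \<in> A then col i else if \<sigma> i = i then 1 else 0))"

end

theory Submission
  imports Defs
begin

text \<open>
  Write \<open>T\<^sub>i(k)\<close> for the cyclic interval from \<open>k\<close> to \<open>i - 1\<close>. The conecklace of a positroid with
  decorated permutation \<open>(\<pi>, col)\<close> is \<open>J\<^sub>i = {k. \<pi> k <\<^sub>i k \<or> col k = -1}\<close>, and \<open>k \<in> J\<^sub>i\<close> iff removing
  \<open>k\<close> from \<open>T\<^sub>i(k)\<close> lowers the rank. For a quotient of corank one the rank difference
  \<open>\<delta> = rk\<^sub>N - rk\<^sub>M\<close> is monotone with values in \<open>{0, 1}\<close>, so \<open>J\<^sup>\<pi>\<^sub>i - J\<^sup>\<sigma>\<^sub>i\<close> consists of the single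
  element \<open>d\<^sub>i\<close>, the \<open><\<^sub>i\<close>-largest \<open>k\<close> with \<open>\<delta>(T\<^sub>i(k)) = 1\<close>. By monotonicity \<open>d\<^sub>i\<close> moves
  weakly forward around the circle as \<open>i\<close> does. An element \<open>k\<close> becomes \<open>d\<^sub>i\<close> just after \<open>i\<close> passes
  \<open>\<sigma> k\<close> and ceases to be \<open>d\<^sub>i\<close> just after \<open>i\<close> passes \<open>\<pi> k\<close>; hence \<open>\<sigma> k = \<pi> k'\<close> for
  the cyclic predecessor \<open>k'\<close> of \<open>k\<close> among the values of \<open>d\<close>. An element that is never \<open>d\<^sub>i\<close>
  lies in the same sets of both conecklaces, which determine its image and its colour.
\<close>

section \<open>Tails of the cyclic orders\<close>

lemma cyc_pos_eq:
  assumes "i \<in> {1..n}" "x \<in> {1..n}"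
  shows "cyc_pos n i x = (if i \<le> x then x - i else x + n - i)"
proof (cases "i \<le> x")
  case True
  then have "x + n - i = (x - i) + n" by simp
  moreover have "x - i < n" using assms by auto
  ultimately show ?thesis using True by (simp only: cyc_pos_def mod_add_self2 mod_less if_True)
next
  case False
  then have "x + n - i < n" using assms by auto
  then show ?thesis using False by (simp add: cyc_pos_def)
qed

text \<open>Without the modulus, facts about cyclic intervals become case distinctions over linear
  inequalities.\<close>

lemma cyc_pos_less_iff:
  assumes "i \<in> {1..n}" "x \<in> {1..n}" "y \<in> {1..n}"
  shows "cyc_pos n i x < cyc_pos n i y \<longleftrightarrow>
    (if i \<le> x then x < y \<or> y < i else x < y \<and> y < i)"
  using assms unfolding cyc_pos_eq[OF assms(1,2)] cyc_pos_eq[OF assms(1,3)]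
  by (auto split: if_splits)

lemma cyc_pos_le_iff:
  assumes "i \<in> {1..n}" "x \<in> {1..n}" "y \<in> {1..n}"
  shows "cyc_pos n i x \<le> cyc_pos n i y \<longleftrightarrow>
    (if i \<le> y then x \<le> y \<and> i \<le> x else x \<le> y \<or> i \<le> x)"
  using cyc_pos_less_iff[OF assms(1,3,2)]
  by (auto simp: not_less[symmetric] simp del: not_less)

lemma inj_on_cyc_pos: "i \<in> {1..n} \<Longrightarrow> inj_on (cyc_pos n i) {1..n}"
  by (rule inj_onI) (auto simp: cyc_pos_eq split: if_splits)

definition cyc_tail :: "nat \<Rightarrow> nat \<Rightarrow> nat \<Rightarrow> nat set" where
  "cyc_tail n i k = {x \<in> {1..n}. cyc_pos n i k \<le> cyc_pos n i x}"

lemma cyc_tail_subset: "cyc_tail n i k \<subseteq> {1..n}"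
  by (auto simp: cyc_tail_def)

lemma finite_cyc_tail [simp]: "finite (cyc_tail n i k)"
  by (rule finite_subset[OF cyc_tail_subset]) simp

lemma cyc_tail_self: "i \<in> {1..n} \<Longrightarrow> cyc_tail n i i = {1..n}"
  by (auto simp: cyc_tail_def cyc_pos_less_iff cyc_pos_le_iff)

text \<open>For distinct \<open>i\<close> and \<open>k\<close> the circle splits into the arcs from
  \<open>k\<close> to \<open>i - 1\<close> and from \<open>i\<close> to \<open>k - 1\<close>.
  Counting in complements thus turns a lower bound in one order into an upper bound in the
  other.\<close>

lemma cyc_tail_compl:
  assumes "i \<in> {1..n}" "k \<in> {1..n}" "i \<noteq> k"
  shows "cyc_tail n i k = {1..n} - cyc_tail n k i"
  using assms by (auto simp: cyc_tail_def cyc_pos_less_iff cyc_pos_le_iff split: if_splits)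

definition cyc_next :: "nat \<Rightarrow> nat \<Rightarrow> nat" where
  "cyc_next n i = (if i = n then 1 else i + 1)"

lemma cyc_next_in: "i \<in> {1..n} \<Longrightarrow> cyc_next n i \<in> {1..n}"
  by (auto simp: cyc_next_def)

text \<open>The case distinction matters: if \<open>k\<close> is the last element, the successor is
  \<open>i\<close>, and \<open>cyc_tail n i i\<close> is the whole circle instead of the empty
  set.\<close>

lemma cyc_tail_minus_self:
  assumes "i \<in> {1..n}" "k \<in> {1..n}"
  shows "cyc_tail n i k - {k} =
    (if cyc_next n k = i then {} else cyc_tail n i (cyc_next n k))"
  using assms cyc_next_in[OF assms(2)]
  by (auto simp: cyc_tail_def cyc_next_def cyc_pos_less_iff cyc_pos_le_iff split: if_splits)

lemma cyc_tail_subset_minus_self: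
  assumes "cyc_pos n i k < cyc_pos n i l"
  shows "cyc_tail n i l \<subseteq> cyc_tail n i k - {k}"
  using assms by (auto simp: cyc_tail_def)

section \<open>The Gale order by counting\<close>

lemma cyc_list_properties:
  assumes "A \<subseteq> {1..n}" "i \<in> {1..n}"
  shows "set (cyc_list n i A) = A" "distinct (cyc_list n i A)"
    "sorted (map (cyc_pos n i) (cyc_list n i A))" "length (cyc_list n i A) = card A"
proof -
  have "finite A" using assms(1) finite_subset by blast
  then show "set (cyc_list n i A) = A" "distinct (cyc_list n i A)"
    "sorted (map (cyc_pos n i) (cyc_list n i A))" "length (cyc_list n i A) = card A"
    by (simp_all add: cyc_list_def)
qed

lemma cyc_list_strict:
  assumes "A \<subseteq> {1..n}" "i \<in> {1..n}" "p < q" "q < card A"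
  shows "cyc_pos n i (cyc_list n i A ! p) < cyc_pos n i (cyc_list n i A ! q)"
proof -
  let ?xs = "cyc_list n i A"
  note L = cyc_list_properties[OF assms(1,2)]
  have "cyc_pos n i (?xs ! p) \<le> cyc_pos n i (?xs ! q)"
    using sorted_nth_mono[OF L(3), of p q] L(4) assms(3,4) by simp
  moreover have "?xs ! p \<noteq> ?xs ! q"
    using L(2,4) assms(3,4) by (simp add: nth_eq_iff_index_eq)
  moreover have "?xs ! p \<in> {1..n}" "?xs ! q \<in> {1..n}"
    using L(1,4) assms nth_mem[of p ?xs] nth_mem[of q ?xs] by auto
  ultimately show ?thesis
    using inj_on_cyc_pos[OF assms(2)] by (metis inj_onD nat_less_le)
qed

lemma card_inter_cyc_tail:
  assumes "A \<subseteq> {1..n}" "i \<in> {1..n}"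
  shows "card (A \<inter> cyc_tail n i k) =
    card {p. p < card A \<and> cyc_pos n i k \<le> cyc_pos n i (cyc_list n i A ! p)}"
proof -
  let ?xs = "cyc_list n i A"
  let ?P = "\<lambda>x. cyc_pos n i k \<le> cyc_pos n i x"
  note L = cyc_list_properties[OF assms]
  have "A \<inter> cyc_tail n i k = set (filter ?P ?xs)"
    using L(1) assms(1) by (auto simp: cyc_tail_def)
  also have "card \<dots> = length (filter ?P ?xs)"
    using L(2) by (metis distinct_card distinct_filter)
  also have "\<dots> = card {p. p < card A \<and> ?P (?xs ! p)}"
    using L(4) by (simp add: length_filter_conv_card)
  finally show ?thesis .
qed

text \<open>A sorted list is entrywise below another of equal length iff at every threshold the
  second has at least as many entries that reach it.\<close>

lemma gale_le_iff:
  assumes A: "A \<subseteq> {1..n}" and B: "B \<subseteq> {1..n}" and i: "i \<in> {1..n}"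
  shows "gale_le n i A B \<longleftrightarrow> card A = card B \<and>
    (\<forall>k\<in>{1..n}. card (A \<inter> cyc_tail n i k) \<le> card (B \<inter> cyc_tail n i k))"
    (is "?L \<longleftrightarrow> ?R")
proof
  let ?xs = "cyc_list n i A" and ?ys = "cyc_list n i B" and ?p = "cyc_pos n i"
  note LA = cyc_list_properties[OF A i] and LB = cyc_list_properties[OF B i]
  {
    assume ?L
    then have len: "card A = card B"
      and le: "\<And>p. p < card A \<Longrightarrow> ?p (?xs ! p) \<le> ?p (?ys ! p)"
      using LA(4) LB(4)
      by (auto simp: gale_le_def list_all2_conv_all_nth cyc_le_def cyc_less_def
          intro: less_imp_le dest!: spec)
    have "card (A \<inter> cyc_tail n i k) \<le> card (B \<inter> cyc_tail n i k)" for k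
      unfolding card_inter_cyc_tail[OF A i] card_inter_cyc_tail[OF B i]
      by (rule card_mono) (use len le in \<open>auto intro: order_trans\<close>)
    then show ?R using len by simp
  next
    assume R: ?R
    have "?p (?xs ! p) < ?p (?ys ! p) \<or> ?xs ! p = ?ys ! p" if p: "p < card A" for p
    proof -
      have xp: "?xs ! p \<in> {1..n}" and yp: "?ys ! p \<in> {1..n}"
        using A B LA LB R p nth_mem[of p ?xs] nth_mem[of p ?ys] by auto
      have "?p (?xs ! p) \<le> ?p (?ys ! p)"
      proof (rule ccontr)
        assume neg: "\<not> ?thesis"
        \<comment> \<open>The offending entry of \<open>A\<close> serves as the threshold: in
          \<open>A\<close> all entries from \<open>p\<close> on reach it, in \<open>B\<close> only
          entries after \<open>p\<close> can.\<close>
        let ?SA = "{q. q < card A \<and> ?p (?xs ! p) \<le> ?p (?xs ! q)}"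
        let ?SB = "{q. q < card B \<and> ?p (?xs ! p) \<le> ?p (?ys ! q)}"
        have "{p..<card A} \<subseteq> ?SA"
          using cyc_list_strict[OF A i, of p] by (fastforce simp: le_less)
        then have "card {p..<card A} \<le> card ?SA" by (intro card_mono) auto
        moreover have "?SB \<subseteq> {Suc p..<card B}"
        proof
          fix q assume q: "q \<in> ?SB"
          have "\<not> q < p"
            using cyc_list_strict[OF B i, of q p] q R p neg by auto
          moreover have "q \<noteq> p" using q neg by auto
          ultimately show "q \<in> {Suc p..<card B}" using q by auto
        qed
        then have "card ?SB \<le> card {Suc p..<card B}" by (intro card_mono) auto
        moreover have "card ?SA \<le> card ?SB"
          using bspec[OF conjunct2[OF R] xp]
          unfolding card_inter_cyc_tail[OF A i] card_inter_cyc_tail[OF B i] .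
        ultimately show False using R p by simp
      qed
      then show ?thesis
        using inj_onD[OF inj_on_cyc_pos[OF i] _ xp yp] by (auto simp: le_less)
    qed
    then show ?L
      using R LA(4) LB(4)
      by (auto simp: gale_le_def list_all2_conv_all_nth cyc_le_def cyc_less_def)
  }
qed

lemma gale_le_antisym:
  assumes A: "A \<subseteq> {1..n}" and B: "B \<subseteq> {1..n}" and i: "i \<in> {1..n}"
    and AB: "gale_le n i A B" and BA: "gale_le n i B A"
  shows "A = B"
proof -
  have "cyc_list n i A = cyc_list n i B"
    by (rule list_all2_antisym[OF _ AB[unfolded gale_le_def] BA[unfolded gale_le_def]])
      (auto simp: cyc_le_def cyc_less_def)
  then show ?thesis
    using cyc_list_properties(1)[OF A i] cyc_list_properties(1)[OF B i] by metis
qed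

section \<open>The conecklace of a decorated permutation\<close>

text \<open>The preimage of the necklace under the permutation: put \<open>j = \<pi> k\<close> in
  the condition on \<open>j\<close>; coloops are fixed points.\<close>

definition perm_conecklace :: "nat \<Rightarrow> decperm \<Rightarrow> nat \<Rightarrow> nat set" where
  "perm_conecklace n = (\<lambda>(\<pi>, col) i. {k\<in>{1..n}. cyc_less n i (\<pi> k) k \<or> col k = -1})"

lemma decorated_permutation_coloop:
  assumes "decorated_permutation n (\<pi>, col)" "x \<in> {1..n}" "col x = -1"
  shows "\<pi> x = x"
proof (rule ccontr)
  assume "\<pi> x \<noteq> x"
  then have "col x = 0" using assms(1,2) by (simp add: decorated_permutation_def)
  then show False using assms(3) by simp
qed

lemma necklace_subset: "necklace n d i \<subseteq> {1..n}"
  by (cases d) (auto simp: necklace_def)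

lemma perm_conecklace_subset: "perm_conecklace n d i \<subseteq> {1..n}"
  by (cases d) (auto simp: perm_conecklace_def)

text \<open>Lets bounds that the positroid states through necklaces be transferred to
  conecklaces.\<close>

lemma card_perm_conecklace_inter:
  assumes d: "decorated_permutation n d" and i: "i \<in> {1..n}" and k: "k \<in> {1..n}"
  shows "card (perm_conecklace n d i \<inter> cyc_tail n i k) = card (necklace n d k \<inter> cyc_tail n i k)"
proof -
  obtain \<pi> col where [simp]: "d = (\<pi>, col)" by (cases d)
  let ?T = "cyc_tail n i k"
  have perm: "\<pi> permutes {1..n}"
    using d by (simp add: decorated_permutation_def)
  note fixp = decorated_permutation_coloop[OF d[unfolded \<open>d = (\<pi>, col)\<close>]]
  have in_n: "\<pi> x \<in> {1..n} \<longleftrightarrow> x \<in> {1..n}" for x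
    using permutes_in_image[OF perm] .
  have inv: "inv \<pi> (\<pi> x) = x" for x
    using permutes_inverses[OF perm] by simp
  \<comment> \<open>The arc \<open>?T\<close> is an upper set for the order from \<open>i\<close>,
    which gives \<open>key\<close>, and a lower set for the order from \<open>k\<close>, which gives
    \<open>pull\<close>.\<close>
  have key: "(\<not> cyc_less n i (\<pi> x) x) \<longleftrightarrow> \<pi> x \<in> ?T \<and> \<not> cyc_less n k (\<pi> x) x"
    if "x \<in> ?T" for x
  proof -
    have x: "x \<in> {1..n}" using that by (auto simp: cyc_tail_def)
    then have y: "\<pi> x \<in> {1..n}" using in_n by simp
    show ?thesis using that x y i k
      by (auto simp: cyc_tail_def cyc_less_def cyc_pos_less_iff cyc_pos_le_iff split: if_splits)
  qed
  have pull: "x \<in> ?T" if "\<pi> x \<in> ?T" "\<not> cyc_less n k (\<pi> x) x" for x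
  proof -
    have y: "\<pi> x \<in> {1..n}" using that by (auto simp: cyc_tail_def)
    then have x: "x \<in> {1..n}" using in_n by simp
    show ?thesis using that x y i k
      by (auto simp: cyc_tail_def cyc_less_def cyc_pos_less_iff cyc_pos_le_iff split: if_splits)
  qed
  have col: "col (\<pi> x) = -1 \<longleftrightarrow> col x = -1" if "x \<in> {1..n}" for x
    using fixp[OF that] fixp[of "\<pi> x"] in_n[of x] that permutes_inj[OF perm]
    by (metis injD)
  \<comment> \<open>On \<open>?T\<close>, the interval from \<open>k\<close> to \<open>i - 1\<close>, the orders from \<open>i\<close> and from \<open>k\<close> agree,
    so \<open>\<pi>\<close> matches up the complements.\<close>
  have "\<pi> ` (?T - perm_conecklace n d i) = ?T - necklace n d k"
  proof (intro set_eqI iffI)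
    fix y assume "y \<in> \<pi> ` (?T - perm_conecklace n d i)"
    then obtain x where "y = \<pi> x" "x \<in> ?T" "\<not> cyc_less n i (\<pi> x) x" "col x \<noteq> -1"
      by (auto simp: perm_conecklace_def cyc_tail_def)
    then show "y \<in> ?T - necklace n d k"
      using key[of x] col[of x] inv[of x] by (auto simp: necklace_def cyc_tail_def)
  next
    fix y assume y: "y \<in> ?T - necklace n d k"
    define x where "x = inv \<pi> y"
    have yx: "y = \<pi> x" using permutes_inverses[OF perm] by (simp add: x_def)
    have *: "\<pi> x \<in> ?T" "\<not> cyc_less n k (\<pi> x) x" "col (\<pi> x) \<noteq> -1"
      using y inv by (auto simp: yx necklace_def cyc_tail_def)
    then have "x \<in> ?T" using pull by simp
    then have "x \<in> ?T - perm_conecklace n d i"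
      using * key[of x] col[of x] by (auto simp: perm_conecklace_def cyc_tail_def)
    then show "y \<in> \<pi> ` (?T - perm_conecklace n d i)" using yx by auto
  qed
  then have "card (?T - perm_conecklace n d i) = card (?T - necklace n d k)"
    using card_image[OF inj_on_subset[OF permutes_inj[OF perm] subset_UNIV]] by metis
  moreover have "card (S \<inter> ?T) = card ?T - card (?T - S)" for S
    by (metis Diff_Diff_Int Diff_subset Int_commute card_Diff_subset finite_Diff finite_cyc_tail)
  ultimately show ?thesis by simp
qed

lemma card_perm_conecklace_le:
  assumes d: "decorated_permutation n d" and i: "i \<in> {1..n}" and a: "a \<in> {1..n}"
    and k: "k \<in> {1..n}"
  shows "card (perm_conecklace n d i \<inter> cyc_tail n a k) \<le>
    card (perm_conecklace n d a \<inter> cyc_tail n a k)"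
proof -
  obtain \<pi> col where [simp]: "d = (\<pi>, col)" by (cases d)
  let ?T = "cyc_tail n a k" and ?Ji = "perm_conecklace n d i" and ?Ja = "perm_conecklace n d a"
  \<comment> \<open>\<open>J\<^sub>i\<close> arises from \<open>J\<^sub>a\<close> by exchanging the elements that \<open>\<pi>\<close> maps into \<open>P\<close> from outside
    for those it maps out of \<open>P\<close>, and \<open>P\<close> is an initial segment for \<open><\<^sub>a\<close>.\<close>
  define P where "P = {x \<in> {1..n}. cyc_less n a x i}"
  have perm: "\<pi> permutes {1..n}" using d by (simp add: decorated_permutation_def)
  have in_n: "\<pi> x \<in> {1..n} \<longleftrightarrow> x \<in> {1..n}" for x
    using permutes_in_image[OF perm] .
  have fin [simp]: "finite ?Ji" "finite ?Ja"
    using finite_subset[OF perm_conecklace_subset] by auto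
  have P: "finite P" "P \<subseteq> {1..n}" by (auto simp: P_def)
  \<comment> \<open>Passing from the order at \<open>a\<close> to the order at \<open>i\<close>
    moves the segment \<open>P\<close> from the bottom to the top, so only comparisons between
    \<open>P\<close> and its complement change.\<close>
  have key: "cyc_less n i y x \<and> \<not> cyc_less n a y x \<longleftrightarrow> x \<in> P \<and> y \<notin> P"
    "cyc_less n a y x \<and> \<not> cyc_less n i y x \<longleftrightarrow> x \<notin> P \<and> y \<in> P"
    if "x \<in> {1..n}" "y \<in> {1..n}" for x y
    using that i a by (auto simp: P_def cyc_less_def cyc_pos_less_iff cyc_pos_le_iff split: if_splits)
  note fixp = decorated_permutation_coloop[OF d[unfolded \<open>d = (\<pi>, col)\<close>]]
  have D1: "?Ji - ?Ja = {x \<in> {1..n}. x \<in> P \<and> \<pi> x \<notin> P}"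
    using key(1)[of _ "\<pi> _"] in_n fixp by (auto simp: perm_conecklace_def)
  have D2: "?Ja - ?Ji = {x \<in> {1..n}. x \<notin> P \<and> \<pi> x \<in> P}"
    using key(2)[of _ "\<pi> _"] in_n fixp by (auto simp: perm_conecklace_def)
  have pre: "\<pi> ` {x \<in> {1..n}. \<pi> x \<in> P} = P"
  proof -
    have "y \<in> \<pi> ` {x \<in> {1..n}. \<pi> x \<in> P}" if "y \<in> P" for y
      using that P permutes_inverses(1)[OF perm, of y] in_n[of "inv \<pi> y"]
      by (intro image_eqI[of _ _ "inv \<pi> y"]) auto
    then show ?thesis by auto
  qed
  \<comment> \<open>\<open>P\<close> and its preimage under the permutation have equal size, so as
    many elements are mapped into \<open>P\<close> from outside as out of it.\<close>
  have "card {x \<in> {1..n}. \<pi> x \<in> P} = card P"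
    using pre card_image[OF inj_on_subset[OF permutes_inj[OF perm] subset_UNIV]] by metis
  moreover have "card {x \<in> {1..n}. \<pi> x \<in> P} =
      card {x \<in> {1..n}. x \<notin> P \<and> \<pi> x \<in> P} + card {x \<in> P. \<pi> x \<in> P}"
    using P by (subst card_Un_disjoint[symmetric]) (auto intro!: arg_cong[of _ _ card])
  moreover have "card P = card {x \<in> {1..n}. x \<in> P \<and> \<pi> x \<notin> P} + card {x \<in> P. \<pi> x \<in> P}"
    using P by (subst card_Un_disjoint[symmetric]) (auto intro!: arg_cong[of _ _ card])
  ultimately have eq: "card (?Ji - ?Ja) = card (?Ja - ?Ji)" using D1 D2 by simp
  have split: "card (X \<inter> ?T) = card (X \<inter> Y \<inter> ?T) + card ((X - Y) \<inter> ?T)" for X Y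
    by (subst card_Un_disjoint[symmetric]) (auto intro!: arg_cong[of _ _ card])
  have "card ((?Ji - ?Ja) \<inter> ?T) \<le> card ((?Ja - ?Ji) \<inter> ?T)"
  proof (cases "k \<in> P")
    case True
    then have "{1..n} - P \<subseteq> ?T" by (auto simp: P_def cyc_tail_def cyc_less_def)
    then have "(?Ja - ?Ji) \<inter> ?T = ?Ja - ?Ji" unfolding D2 by auto
    then show ?thesis using eq by (metis Int_lower1 card_mono fin(1) finite_Diff)
  next
    case False
    then have "P \<inter> ?T = {}" using k by (auto simp: P_def cyc_tail_def cyc_less_def)
    then have "(?Ji - ?Ja) \<inter> ?T = {}" unfolding D1 by auto
    then show ?thesis by simp
  qed
  then show ?thesis
    using split[of ?Ji ?Ja] split[of ?Ja ?Ji] by (simp add: Int_commute Int_left_commute)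
qed

lemma card_Int_compl:
  assumes "finite E" "X \<subseteq> E" "T = E - S"
  shows "card (X \<inter> T) = card X - card (X \<inter> S)"
proof -
  have "X \<inter> T = X - X \<inter> S" using assms by auto
  then show ?thesis using assms by (metis Int_lower1 card_Diff_subset finite_Int finite_subset)
qed

lemma card_perm_conecklace:
  assumes d: "decorated_permutation n d" and i: "i \<in> {1..n}" and k: "k \<in> {1..n}"
  shows "card (perm_conecklace n d i) = card (necklace n d k)"
proof -
  have all: "X \<inter> {1..n} = X" if "X \<subseteq> {1..n}" for X :: "nat set" using that by auto
  note [simp] = all[OF perm_conecklace_subset] all[OF necklace_subset]
  have "card (perm_conecklace n d i) \<le> card (perm_conecklace n d k)"
    using card_perm_conecklace_le[OF d i k k] by (simp add: cyc_tail_self[OF k] del: One_nat_def)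
  moreover have "card (perm_conecklace n d k) \<le> card (perm_conecklace n d i)"
    using card_perm_conecklace_le[OF d k i i] by (simp add: cyc_tail_self[OF i] del: One_nat_def)
  moreover have "card (perm_conecklace n d k) = card (necklace n d k)"
    using card_perm_conecklace_inter[OF d k k] by (simp add: cyc_tail_self[OF k] del: One_nat_def)
  ultimately show ?thesis by simp
qed

text \<open>On complementary arcs, the Gale condition at \<open>a\<close> asks that
  \<open>J\<^sub>i\<close> have no more elements in \<open>cyc_tail n k a\<close> than the necklace
  at \<open>a\<close>. That necklace has as many there as \<open>J\<^sub>k\<close>, which dominates
  \<open>J\<^sub>i\<close> in the order from \<open>k\<close>.\<close>

lemma perm_conecklace_basis:
  assumes d: "decorated_permutation n d" and i: "i \<in> {1..n}"
  shows "perm_conecklace n d i \<in> positroid_bases n d"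
proof -
  let ?J = "perm_conecklace n d"
  have "gale_le n a (necklace n d a) (?J i)" if a: "a \<in> {1..n}" for a
    unfolding gale_le_iff[OF necklace_subset perm_conecklace_subset a]
  proof (intro conjI ballI)
    show eq: "card (necklace n d a) = card (?J i)"
      using card_perm_conecklace[OF d i a] by simp
    fix k assume k: "k \<in> {1..n}"
    show "card (necklace n d a \<inter> cyc_tail n a k) \<le> card (?J i \<inter> cyc_tail n a k)"
    proof (cases "a = k")
      case True
      then show ?thesis using eq necklace_subset[of n d a] perm_conecklace_subset[of n d i]
        by (simp add: cyc_tail_self[OF k] Int_absorb2)
    next
      case False
      have "card (?J i \<inter> cyc_tail n k a) \<le> card (necklace n d a \<inter> cyc_tail n k a)"
        using card_perm_conecklace_le[OF d i k a] card_perm_conecklace_inter[OF d k a] by simp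
      then show ?thesis
        using card_Int_compl[OF _ necklace_subset cyc_tail_compl[OF a k False]]
          card_Int_compl[OF _ perm_conecklace_subset cyc_tail_compl[OF a k False]] eq
        by (simp add: diff_le_mono2)
    qed
  qed
  moreover have "1 \<in> {1..n}" using i by auto
  ultimately show ?thesis
    using card_perm_conecklace[OF d i] perm_conecklace_subset
    unfolding positroid_bases_def by blast
qed

text \<open>The Gale condition at \<open>k\<close> bounds \<open>B\<close> from below on
  \<open>cyc_tail n k i\<close>, hence from above on the complementary arc, where the necklace at
  \<open>k\<close> and \<open>J\<^sub>i\<close> have equally many elements.\<close>

lemma card_basis_inter_le:
  assumes d: "decorated_permutation n d" and B: "B \<in> positroid_bases n d"
    and i: "i \<in> {1..n}" and k: "k \<in> {1..n}"
  shows "card (B \<inter> cyc_tail n i k) \<le> card (perm_conecklace n d i \<inter> cyc_tail n i k)"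
proof -
  have sub: "B \<subseteq> {1..n}" and gale: "gale_le n k (necklace n d k) B"
    using B k by (auto simp: positroid_bases_def)
  note G = gale[unfolded gale_le_iff[OF necklace_subset sub k]]
  show ?thesis
  proof (cases "i = k")
    case True
    then show ?thesis
      using G card_perm_conecklace[OF d i k] sub perm_conecklace_subset[of n d i]
      by (simp add: cyc_tail_self[OF k] Int_absorb2)
  next
    case False
    then show ?thesis
      using G i card_Int_compl[OF _ sub cyc_tail_compl[OF i k False]]
        card_Int_compl[OF _ necklace_subset cyc_tail_compl[OF i k False]]
      by (simp add: card_perm_conecklace_inter[OF d i k] diff_le_mono2)
  qed
qed

lemma conecklace_positroid_bases:
  assumes d: "decorated_permutation n d" and i: "i \<in> {1..n}"
  shows "conecklace n (positroid_bases n d) i = perm_conecklace n d i"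
  unfolding conecklace_def
proof (rule the_equality)
  have sub: "B \<subseteq> {1..n}" "card B = card (perm_conecklace n d i)" if "B \<in> positroid_bases n d" for B
  proof -
    show "B \<subseteq> {1..n}" using that by (auto simp: positroid_bases_def)
    have "1 \<in> {1..n}" using i by auto
    then show "card B = card (perm_conecklace n d i)"
      using that card_perm_conecklace[OF d i, of 1] by (auto simp: positroid_bases_def)
  qed
  have "gale_le n i B (perm_conecklace n d i)" if B: "B \<in> positroid_bases n d" for B
    unfolding gale_le_iff[OF sub(1)[OF B] perm_conecklace_subset i]
    using sub(2)[OF B] card_basis_inter_le[OF d B i] by blast
  then show *: "perm_conecklace n d i \<in> positroid_bases n d \<and>
      (\<forall>B\<in>positroid_bases n d. gale_le n i B (perm_conecklace n d i))"
    using perm_conecklace_basis[OF d i] by blast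
  show "J = perm_conecklace n d i"
    if J: "J \<in> positroid_bases n d \<and> (\<forall>B\<in>positroid_bases n d. gale_le n i B J)" for J
  proof (rule gale_le_antisym[OF _ perm_conecklace_subset i])
    show "J \<subseteq> {1..n}" using J sub(1) by blast
    show "gale_le n i J (perm_conecklace n d i)" using J * by blast
    show "gale_le n i (perm_conecklace n d i) J" using J * by blast
  qed
qed

section \<open>Matroid rank and quotients\<close>

lemma matroid_exchange:
  assumes "matroid E \<B>" "A \<in> \<B>" "B \<in> \<B>" "x \<in> A - B"
  shows "\<exists>y\<in>B - A. insert y (A - {x}) \<in> \<B>"
  using assms unfolding matroid_def by blast

lemma matroid_finite_basis: "matroid E \<B> \<Longrightarrow> B \<in> \<B> \<Longrightarrow> finite B"
  unfolding matroid_def by (metis finite_subset)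

lemma matroid_bases_card_eq:
  assumes m: "matroid E \<B>" and "A \<in> \<B>" and B: "B \<in> \<B>"
  shows "card A = card B"
  using \<open>A \<in> \<B>\<close>
proof (induction "card (A - B)" arbitrary: A rule: less_induct)
  case less
  note fin = matroid_finite_basis[OF m]
  show ?case
  proof (cases "A \<subseteq> B")
    case True
    have "B \<subseteq> A"
    proof
      fix x assume "x \<in> B"
      show "x \<in> A"
      proof (rule ccontr)
        assume "x \<notin> A"
        then obtain y where "y \<in> A - B"
          using matroid_exchange[OF m B less.prems] \<open>x \<in> B\<close> by blast
        then show False using True by blast
      qed
    qed
    then show ?thesis using True by simp
  next
    case False
    then obtain x where x: "x \<in> A - B" by blast
    then obtain y where y: "y \<in> B - A" "insert y (A - {x}) \<in> \<B>"
      using matroid_exchange[OF m less.prems B] by blast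
    have "insert y (A - {x}) - B = A - B - {x}" using y by auto
    then have "card (insert y (A - {x}) - B) < card (A - B)"
      using fin[OF less.prems] x by (metis card_Diff1_less finite_Diff)
    then have "card (insert y (A - {x})) = card B" using less.hyps y(2) by blast
    moreover have "card (insert y (A - {x})) = card A"
      using x y fin[OF less.prems] card.remove[of A x] by simp
    ultimately show ?thesis by simp
  qed
qed

lemma indep_mono: "indep \<B> Y \<Longrightarrow> X \<subseteq> Y \<Longrightarrow> indep \<B> X"
  unfolding indep_def by blast

lemma matroid_indep_subset: "matroid E \<B> \<Longrightarrow> indep \<B> X \<Longrightarrow> X \<subseteq> E"
  unfolding indep_def matroid_def by blast

text \<open>Choose a basis \<open>B1\<close> above \<open>X\<close> closest to a basis
  \<open>B2\<close> above \<open>Y\<close>. Exchange and minimality force \<open>B1 - X\<close> into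
  \<open>B2\<close>; if \<open>B1\<close> also missed \<open>Y - X\<close>, comparing sizes would
  give \<open>card Y \<le> card X\<close>.\<close>

lemma matroid_augment:
  assumes m: "matroid E \<B>" and X: "indep \<B> X" and Y: "indep \<B> Y" and less: "card X < card Y"
  shows "\<exists>y\<in>Y - X. indep \<B> (insert y X)"
proof -
  note fin = matroid_finite_basis[OF m]
  obtain B2 where B2: "B2 \<in> \<B>" "Y \<subseteq> B2" using Y by (auto simp: indep_def)
  obtain B0 where "B0 \<in> \<B> \<and> X \<subseteq> B0" using X by (auto simp: indep_def)
  from ex_has_least_nat[of "\<lambda>B. B \<in> \<B> \<and> X \<subseteq> B", OF this, of "\<lambda>B. card (B - B2)"]
  obtain B1 where B1: "B1 \<in> \<B>" "X \<subseteq> B1"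
    and min: "\<And>B. B \<in> \<B> \<Longrightarrow> X \<subseteq> B \<Longrightarrow> card (B1 - B2) \<le> card (B - B2)"
    by auto
  have sub: "B1 - X \<subseteq> B2"
  proof
    fix x assume x: "x \<in> B1 - X"
    show "x \<in> B2"
    proof (rule ccontr)
      assume "x \<notin> B2"
      then obtain y where y: "y \<in> B2 - B1" "insert y (B1 - {x}) \<in> \<B>"
        using matroid_exchange[OF m B1(1) B2(1)] x by blast
      have "insert y (B1 - {x}) - B2 = B1 - B2 - {x}" using y by auto
      then have "card (insert y (B1 - {x}) - B2) < card (B1 - B2)"
        using fin[OF B1(1)] x \<open>x \<notin> B2\<close> by (metis Diff_iff card_Diff1_less finite_Diff)
      moreover have "X \<subseteq> insert y (B1 - {x})" using B1(2) x by blast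
      ultimately show False using min[OF y(2)] by simp
    qed
  qed
  have "\<exists>y\<in>Y - X. y \<in> B1"
  proof (rule ccontr)
    assume "\<not> ?thesis"
    then have "B1 - X \<subseteq> B2 - Y" using sub by blast
    then have "card (B1 - X) \<le> card (B2 - Y)" using fin[OF B2(1)] by (intro card_mono) auto
    moreover have "card (B1 - X) = card B1 - card X" "card (B2 - Y) = card B2 - card Y"
      "card Y \<le> card B2"
      using card_Diff_subset[OF finite_subset[OF B1(2)] B1(2)]
        card_Diff_subset[OF finite_subset[OF B2(2)] B2(2)] card_mono[OF _ B2(2)]
        fin[OF B1(1)] fin[OF B2(1)] by blast+
    ultimately show False using less matroid_bases_card_eq[OF m B1(1) B2(1)] by simp
  qed
  then obtain y where "y \<in> Y - X" "y \<in> B1" by blast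
  moreover have "indep \<B> (insert y X)" using \<open>y \<in> B1\<close> B1 by (auto simp: indep_def)
  ultimately show ?thesis by blast
qed

section \<open>The rank function\<close>

definition mrank :: "'a set set \<Rightarrow> 'a set \<Rightarrow> nat" where
  "mrank \<B> X = Max (card ` {Y. indep \<B> Y \<and> Y \<subseteq> X})"

lemma card_le_mrank: "finite X \<Longrightarrow> indep \<B> Y \<Longrightarrow> Y \<subseteq> X \<Longrightarrow> card Y \<le> mrank \<B> X"
  unfolding mrank_def by (rule Max_ge) (auto intro: finite_subset[of _ "Pow X"])

lemma mrank_attained:
  assumes "finite X" "\<B> \<noteq> {}"
  obtains Y where "indep \<B> Y" "Y \<subseteq> X" "card Y = mrank \<B> X"
proof -
  have "finite (card ` {Y. indep \<B> Y \<and> Y \<subseteq> X})"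
    using assms(1) by (auto intro: finite_subset[of _ "Pow X"])
  moreover have "{} \<in> {Y. indep \<B> Y \<and> Y \<subseteq> X}" using assms(2) by (auto simp: indep_def)
  ultimately have "mrank \<B> X \<in> card ` {Y. indep \<B> Y \<and> Y \<subseteq> X}"
    unfolding mrank_def by (intro Max_in) blast+
  then show ?thesis using that by auto
qed

lemma mrank_mono:
  assumes "finite Y" "\<B> \<noteq> {}" "X \<subseteq> Y"
  shows "mrank \<B> X \<le> mrank \<B> Y"
proof -
  obtain Z where "indep \<B> Z" "Z \<subseteq> X" "card Z = mrank \<B> X"
    using mrank_attained[OF finite_subset[OF assms(3,1)] assms(2)] by blast
  then show ?thesis using card_le_mrank[OF assms(1), of \<B> Z] assms(3) by auto
qed

lemma mrank_empty: "\<B> \<noteq> {} \<Longrightarrow> mrank \<B> {} = 0"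
  using mrank_attained[of "{}" \<B>] by (metis card.empty finite.emptyI subset_empty)

lemma mrank_insert_le:
  assumes "finite X" "\<B> \<noteq> {}"
  shows "mrank \<B> (insert e X) \<le> Suc (mrank \<B> X)"
proof -
  obtain Z where Z: "indep \<B> Z" "Z \<subseteq> insert e X" "card Z = mrank \<B> (insert e X)"
    using mrank_attained[of "insert e X" \<B>] assms by auto
  have "card (Z - {e}) \<le> mrank \<B> X"
    using Z assms(1) by (intro card_le_mrank) (auto intro: indep_mono)
  then show ?thesis using Z(3) by (auto simp: card_Diff_singleton_if split: if_splits)
qed

lemma mrank_ground:
  assumes "matroid E \<B>"
  shows "mrank \<B> E = rk \<B>"
proof -
  have "{Y. indep \<B> Y \<and> Y \<subseteq> E} = {Y. indep \<B> Y}"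
    using matroid_indep_subset[OF assms] by blast
  then show ?thesis by (simp add: mrank_def rk_def)
qed

lemma matroid_extend_indep:
  assumes m: "matroid E \<B>" and X: "finite X" and Y: "indep \<B> Y" "Y \<subseteq> X"
  obtains Z where "indep \<B> Z" "Y \<subseteq> Z" "Z \<subseteq> X" "card Z = mrank \<B> X"
proof -
  have ne: "\<B> \<noteq> {}" using m by (simp add: matroid_def)
  have "\<exists>Z. indep \<B> Z \<and> Y \<subseteq> Z \<and> Z \<subseteq> X \<and> card Z = mrank \<B> X"
    using Y
  proof (induction "mrank \<B> X - card Y" arbitrary: Y rule: less_induct)
    case less
    have le: "card Y \<le> mrank \<B> X" using card_le_mrank[OF X less.prems] .
    show ?case
    proof (cases "card Y = mrank \<B> X")
      case True
      then show ?thesis using less.prems by blast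
    next
      case False
      obtain W where W: "indep \<B> W" "W \<subseteq> X" "card W = mrank \<B> X"
        using mrank_attained[OF X ne] .
      then obtain y where y: "y \<in> W - Y" "indep \<B> (insert y Y)"
        using matroid_augment[OF m less.prems(1) W(1)] le False by auto
      have "card (insert y Y) = Suc (card Y)"
        using y(1) finite_subset[OF less.prems(2) X] by simp
      moreover have "insert y Y \<subseteq> X" using y(1) W(2) less.prems(2) by blast
      ultimately have "\<exists>Z. indep \<B> Z \<and> insert y Y \<subseteq> Z \<and> Z \<subseteq> X \<and> card Z = mrank \<B> X"
        using y(2) le False by (intro less.hyps) simp_all
      then show ?thesis by blast
    qed
  qed
  then show ?thesis using that by blast
qed

section \<open>Circuits, and quotients in terms of rank\<close>

lemma dependent_contains_circuit:
  assumes "finite X" "X \<subseteq> E" "\<not> indep \<B> X"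
  obtains C where "C \<in> circuits E \<B>" "C \<subseteq> X"
proof -
  have "\<exists>C\<in>circuits E \<B>. C \<subseteq> X"
    using assms
  proof (induction X rule: finite_psubset_induct)
    case (psubset X)
    show ?case
    proof (cases "\<exists>Y. Y \<subset> X \<and> \<not> indep \<B> Y")
      case True
      then obtain Y where "Y \<subset> X" "\<not> indep \<B> Y" by blast
      then show ?thesis using psubset.IH[of Y] psubset.prems by blast
    next
      case False
      then show ?thesis using psubset.prems by (auto simp: circuits_def)
    qed
  qed
  then show ?thesis using that by blast
qed

text \<open>This is the closure form of a quotient. If \<open>e\<close> does not raise the rank in
  \<open>N\<close>, it lies on a circuit \<open>C\<close> of \<open>N\<close> inside
  \<open>insert e X\<close>. As \<open>C\<close> is a union of circuits of \<open>M\<close>, one of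
  these contains \<open>e\<close>, so \<open>e\<close> does not raise the rank in \<open>M\<close>
  either.\<close>

lemma quotient_mrank_insert:
  assumes M: "matroid E M" and E: "finite E" and N: "N \<noteq> {}" and q: "quotient_of E M N"
    and X: "insert e X \<subseteq> E" and e: "e \<notin> X"
    and eq: "mrank N (insert e X) = mrank N X"
  shows "mrank M (insert e X) = mrank M X"
proof (rule ccontr)
  assume neq: "mrank M (insert e X) \<noteq> mrank M X"
  have fin: "finite X" "finite (insert e X)" using finite_subset[OF X E] by auto
  have ne: "M \<noteq> {}" using M by (simp add: matroid_def)
  obtain K where K: "indep N K" "K \<subseteq> X" "card K = mrank N X"
    using mrank_attained[OF fin(1) N] .
  have "\<not> indep N (insert e K)"
  proof
    assume "indep N (insert e K)"
    then have "card (insert e K) \<le> mrank N (insert e X)"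
      using K(2) fin(2) by (intro card_le_mrank) auto
    moreover have "card (insert e K) = Suc (card K)"
      using K(2) e finite_subset[OF K(2) fin(1)] by (auto simp: card_insert_if)
    ultimately show False using eq K(3) by simp
  qed
  moreover have "insert e K \<subseteq> E" using X K(2) by blast
  moreover have "finite (insert e K)" using finite_subset[OF K(2) fin(1)] by simp
  ultimately obtain C where C: "C \<in> circuits E N" "C \<subseteq> insert e K"
    using dependent_contains_circuit by metis
  have "e \<in> C"
  proof (rule ccontr)
    assume "e \<notin> C"
    then have "indep N C" using C(2) K(1) indep_mono by blast
    then show False using C(1) by (simp add: circuits_def)
  qed
  moreover have "\<exists>\<C>\<subseteq>circuits E M. C = \<Union>\<C>"
    using q C(1) by (simp add: quotient_of_def)
  ultimately obtain D where D: "D \<in> circuits E M" "e \<in> D" "D \<subseteq> C" by auto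
  \<comment> \<open>A maximum independent subset \<open>L\<close> of \<open>X\<close> is built
    around \<open>D - {e}\<close>. If the rank rose, \<open>L\<close> could be augmented, but only
    by \<open>e\<close>, which would make \<open>D\<close> independent.\<close>
  have "D - {e} \<subset> D" using D(2) by auto
  then have "indep M (D - {e})" using D(1) by (simp add: circuits_def)
  moreover have "D - {e} \<subseteq> X" using D(3) C(2) K(2) by blast
  ultimately obtain L where L: "indep M L" "D - {e} \<subseteq> L" "L \<subseteq> X" "card L = mrank M X"
    using matroid_extend_indep[OF M fin(1)] by metis
  obtain W where W: "indep M W" "W \<subseteq> insert e X" "card W = mrank M (insert e X)"
    using mrank_attained[OF fin(2) ne] .
  have "card L < card W"
    using neq L(4) W(3) mrank_mono[OF fin(2) ne subset_insertI] by simp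
  then obtain y where y: "y \<in> W - L" "indep M (insert y L)"
    using matroid_augment[OF M L(1) W(1)] by blast
  have "y \<notin> X"
  proof
    assume "y \<in> X"
    then have "card (insert y L) \<le> mrank M X"
      using y(2) L(3) fin(1) by (intro card_le_mrank) auto
    then show False using y(1) L(3,4) finite_subset[OF L(3) fin(1)] by simp
  qed
  then have "y = e" using y(1) W(2) by blast
  then have "indep M D" using indep_mono[OF y(2)] L(2) by blast
  then show False using D(1) by (simp add: circuits_def)
qed

text \<open>The difference of the two ranks is monotone, written with sums to avoid truncated
  subtraction. Add elements one by one: whenever the rank in \<open>M\<close> grows, it grows by one
  and the rank in \<open>N\<close> must grow too.\<close>

lemma quotient_mrank_diff_mono:
  assumes M: "matroid E M" and E: "finite E" and N: "N \<noteq> {}" and q: "quotient_of E M N"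
    and XY: "X \<subseteq> Y" and Y: "Y \<subseteq> E"
  shows "mrank M Y + mrank N X \<le> mrank N Y + mrank M X"
proof -
  have fE: "finite Z" if "Z \<subseteq> E" for Z using finite_subset[OF that E] .
  have ne: "M \<noteq> {}" using M by (simp add: matroid_def)
  have "mrank M (X \<union> F) + mrank N X \<le> mrank N (X \<union> F) + mrank M X"
    if "finite F" "F \<subseteq> E - X" for F
    using that
  proof (induction F rule: finite_induct)
    case empty
    show ?case by simp
  next
    case (insert e F)
    have sub: "insert e (X \<union> F) \<subseteq> E" "e \<notin> X \<union> F" using insert XY Y by auto
    have fin: "finite (X \<union> F)" "finite (insert e (X \<union> F))" using fE[OF sub(1)] by auto
    have IH: "mrank M (X \<union> F) + mrank N X \<le> mrank N (X \<union> F) + mrank M X"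
      using insert.IH insert.prems by simp
    have "mrank N (X \<union> F) \<le> mrank N (insert e (X \<union> F))"
      using mrank_mono[OF fin(2) N subset_insertI] .
    moreover have "mrank M (insert e (X \<union> F)) \<le> Suc (mrank M (X \<union> F))"
      using mrank_insert_le[OF fin(1) ne] .
    moreover note quotient_mrank_insert[OF M E N q sub]
    ultimately have "mrank M (insert e (X \<union> F)) + mrank N X \<le> mrank N (insert e (X \<union> F)) + mrank M X"
      using IH by linarith
    then show ?case by simp
  qed
  from this[of "Y - X"] show ?thesis using XY Y fE by (simp add: Un_absorb1 Diff_mono)
qed

section \<open>Ranks of cyclic intervals\<close>

text \<open>No basis meets the tail in more elements than \<open>J\<^sub>i\<close>, so
  \<open>J\<^sub>i\<close> cuts out a maximum independent subset.\<close>

lemma mrank_cyc_tail: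
  assumes d: "decorated_permutation n d" and i: "i \<in> {1..n}" and k: "k \<in> {1..n}"
  shows "mrank (positroid_bases n d) (cyc_tail n i k) =
    card (perm_conecklace n d i \<inter> cyc_tail n i k)"
proof (rule antisym)
  let ?M = "positroid_bases n d" and ?T = "cyc_tail n i k" and ?J = "perm_conecklace n d i"
  note J = perm_conecklace_basis[OF d i]
  have "?M \<noteq> {}" using J by blast
  then obtain Y where Y: "indep ?M Y" "Y \<subseteq> ?T" "card Y = mrank ?M ?T"
    using mrank_attained[OF finite_cyc_tail] by metis
  then obtain B where B: "B \<in> ?M" "Y \<subseteq> B" by (auto simp: indep_def)
  have "card Y \<le> card (B \<inter> ?T)" using B(2) Y(2) by (intro card_mono) auto
  then show "mrank ?M ?T \<le> card (?J \<inter> ?T)"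
    using card_basis_inter_le[OF d B(1) i k] Y(3) by simp
  show "card (?J \<inter> ?T) \<le> mrank ?M ?T"
    using J by (intro card_le_mrank finite_cyc_tail) (auto simp: indep_def)
qed

text \<open>Without \<open>k\<close> the tail is again a tail or empty, so the same count of
  \<open>J\<^sub>i\<close> gives both ranks.\<close>

lemma mrank_cyc_tail_minus_self:
  assumes d: "decorated_permutation n d" and i: "i \<in> {1..n}" and k: "k \<in> {1..n}"
  shows "mrank (positroid_bases n d) (cyc_tail n i k) =
    mrank (positroid_bases n d) (cyc_tail n i k - {k}) +
    (if k \<in> perm_conecklace n d i then 1 else 0)"
proof -
  let ?M = "positroid_bases n d" and ?T = "cyc_tail n i k" and ?J = "perm_conecklace n d i"
  have ne: "?M \<noteq> {}" using perm_conecklace_basis[OF d i] by blast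
  have "mrank ?M (?T - {k}) = card (?J \<inter> (?T - {k}))"
    using mrank_cyc_tail[OF d i cyc_next_in[OF k]] mrank_empty[OF ne]
    unfolding cyc_tail_minus_self[OF i k] by simp
  also have "?J \<inter> (?T - {k}) = ?J \<inter> ?T - {k}" by blast
  finally have "mrank ?M (?T - {k}) = card (?J \<inter> ?T - {k})" .
  moreover have "k \<in> ?T" using k by (simp add: cyc_tail_def)
  moreover have "finite (?J \<inter> ?T)" by simp
  ultimately show ?thesis
    unfolding mrank_cyc_tail[OF d i k] using card.remove[of "?J \<inter> ?T" k] by simp
qed

section \<open>From jumps to the cyclic shift\<close>

lemma cyc_pos_self: "i \<in> {1..n} \<Longrightarrow> cyc_pos n i i = 0"
  by (simp add: cyc_pos_eq)

lemma cyc_pos_next_max: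
  assumes "i \<in> {1..n}" "k \<in> {1..n}"
  shows "cyc_pos n (cyc_next n i) k \<le> cyc_pos n (cyc_next n i) i"
  using assms cyc_next_in[OF assms(1)]
  by (auto simp: cyc_next_def cyc_pos_le_iff split: if_splits)

lemma cyc_pos_next_less_iff:
  assumes "i \<in> {1..n}" "x \<in> {1..n}" "y \<in> {1..n}" "x \<noteq> i" "y \<noteq> i"
  shows "cyc_pos n (cyc_next n i) x < cyc_pos n (cyc_next n i) y \<longleftrightarrow>
    cyc_pos n i x < cyc_pos n i y"
  using assms cyc_next_in[OF assms(1)]
  by (auto simp: cyc_next_def cyc_pos_less_iff split: if_splits)

text \<open>The arc from \<open>j\<close> to \<open>i\<close> runs through \<open>x\<close> and then
  \<open>k\<close>, and a start just after \<open>i\<close> does not cut it.\<close>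

lemma cyc_pos_next_less_trans:
  assumes "i \<in> {1..n}" "j \<in> {1..n}" "x \<in> {1..n}" "k \<in> {1..n}"
    and "cyc_pos n j x < cyc_pos n j k" "cyc_pos n j k \<le> cyc_pos n j i"
  shows "cyc_pos n (cyc_next n i) x < cyc_pos n (cyc_next n i) k"
  using assms cyc_next_in[OF assms(1)]
  by (auto simp: cyc_next_def cyc_pos_less_iff cyc_pos_le_iff split: if_splits)

text \<open>The hypotheses place \<open>k\<close>, \<open>i\<close>, \<open>l\<close>,
  \<open>u\<close> around the circle in this order, with \<open>k = i\<close> or
  \<open>i = l\<close> possible; both conclusions are read off from it.\<close>

lemma cyc_pos_between:
  assumes "i \<in> {1..n}" "k \<in> {1..n}" "l \<in> {1..n}" "u \<in> {1..n}" "l \<noteq> k"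
    and "cyc_pos n k l < cyc_pos n k u"
    and "l = i \<or> cyc_pos n (cyc_next n i) l < cyc_pos n (cyc_next n i) k"
  shows "cyc_pos n i l < cyc_pos n i u"
    "cyc_pos n (cyc_next n i) u < cyc_pos n (cyc_next n i) k"
  using assms cyc_next_in[OF assms(1)]
  by (auto simp: cyc_next_def cyc_pos_less_iff cyc_pos_le_iff split: if_splits)

lemma cyc_tail_next_superset:
  assumes "i \<in> {1..n}" "l \<in> {1..n}" "l \<noteq> i"
  shows "cyc_tail n i l \<subseteq> cyc_tail n (cyc_next n i) l"
  using assms cyc_next_in[OF assms(1)]
  by (auto simp: cyc_tail_def cyc_next_def cyc_pos_le_iff split: if_splits)

text \<open>The arcs that begin at \<open>u\<close> form a chain in which those ending at
  \<open>i - 1\<close> and at \<open>i\<close> are neighbours.\<close>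

lemma cyc_tail_comparable:
  assumes "i \<in> {1..n}" "j \<in> {1..n}" "u \<in> {1..n}" "u \<noteq> i"
  shows "cyc_tail n j u \<subseteq> cyc_tail n i u \<or> cyc_tail n (cyc_next n i) u \<subseteq> cyc_tail n j u"
proof (cases "j \<noteq> u \<and> cyc_pos n u j \<le> cyc_pos n u i")
  case True
  then have "cyc_tail n j u \<subseteq> cyc_tail n i u"
    using assms by (auto simp: cyc_tail_def cyc_pos_le_iff split: if_splits)
  then show ?thesis ..
next
  case False
  then have "cyc_tail n (cyc_next n i) u \<subseteq> cyc_tail n j u"
    using assms cyc_next_in[OF assms(1)]
    by (auto simp: cyc_tail_def cyc_next_def cyc_pos_le_iff split: if_splits)
  then show ?thesis ..
qed

text \<open>The \<open>i\<close> with \<open>x <\<^sub>i k\<close> form the arc from just after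
  \<open>k\<close> up to \<open>x\<close>, or the empty set if \<open>x = k\<close>, so this set
  reveals \<open>x\<close>.\<close>

lemma cyc_less_determines:
  assumes "x \<in> {1..n}" "y \<in> {1..n}" "k \<in> {1..n}"
    and "\<And>i. i \<in> {1..n} \<Longrightarrow> cyc_less n i x k \<longleftrightarrow> cyc_less n i y k"
  shows "x = y"
  using assms(4)[OF assms(1)] assms(4)[OF assms(2)] assms(1-3)
  by (auto simp: cyc_less_def cyc_pos_less_iff split: if_splits)

lemma mem_perm_conecklace:
  "k \<in> perm_conecklace n (\<pi>, col) i \<longleftrightarrow> k \<in> {1..n} \<and> (cyc_less n i (\<pi> k) k \<or> col k = -1)"
  by (simp add: perm_conecklace_def)

text \<open>\<open>D\<close> stands for the sets on which the rank difference of \<open>N\<close> and \<open>M\<close> is \<open>1\<close>;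
  \<open>jump n D i k\<close> then says that \<open>k\<close> is the element \<open>d\<^sub>i\<close>.\<close>

definition jump :: "nat \<Rightarrow> (nat set \<Rightarrow> bool) \<Rightarrow> nat \<Rightarrow> nat \<Rightarrow> bool" where
  "jump n D i k \<longleftrightarrow> k \<in> {1..n} \<and> D (cyc_tail n i k) \<and> \<not> D (cyc_tail n i k - {k})"

text \<open>For fixed \<open>i\<close> the tails form a chain, along which a monotone predicate
  changes only once.\<close>

lemma jump_unique:
  assumes mono: "\<And>X Y. X \<subseteq> Y \<Longrightarrow> Y \<subseteq> {1..n} \<Longrightarrow> D X \<Longrightarrow> D Y"
    and i: "i \<in> {1..n}" and k: "jump n D i k" and l: "jump n D i l"
  shows "k = l"
proof -
  have "\<not> cyc_pos n i a < cyc_pos n i b" if "jump n D i a" "jump n D i b" for a b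
  proof
    assume "cyc_pos n i a < cyc_pos n i b"
    then have "cyc_tail n i b \<subseteq> cyc_tail n i a - {a}" by (rule cyc_tail_subset_minus_self)
    moreover have "cyc_tail n i a - {a} \<subseteq> {1..n}" using cyc_tail_subset by blast
    ultimately show False using mono that unfolding jump_def by blast
  qed
  from this[OF k l] this[OF l k] have "cyc_pos n i k = cyc_pos n i l" by simp
  then show ?thesis
    using inj_onD[OF inj_on_cyc_pos[OF i]] k l by (simp add: jump_def)
qed

text \<open>Take the last \<open>k\<close> whose tail satisfies \<open>D\<close>; \<open>i\<close>
  itself is a candidate. What remains of that tail after \<open>k\<close> is a later tail or
  empty.\<close>

lemma jump_exists:
  assumes full: "D {1..n}" and empty: "\<not> D {}" and i: "i \<in> {1..n}"
  shows "\<exists>k. jump n D i k"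
proof -
  let ?P = "\<lambda>k. k \<in> {1..n} \<and> D (cyc_tail n i k)"
  have "?P i" using full i by (simp add: cyc_tail_self)
  moreover have "\<forall>k. ?P k \<longrightarrow> cyc_pos n i k < n"
    using i by (auto simp: cyc_pos_def)
  ultimately have "\<exists>k. ?P k \<and> (\<forall>y. ?P y \<longrightarrow> cyc_pos n i y \<le> cyc_pos n i k)"
    by (rule ex_has_greatest_nat)
  then obtain k where k: "?P k" and max: "\<And>y. ?P y \<Longrightarrow> cyc_pos n i y \<le> cyc_pos n i k"
    by auto
  have kn: "k \<in> {1..n}" using k by simp
  have "\<not> D (cyc_tail n i k - {k})"
  proof
    assume D: "D (cyc_tail n i k - {k})"
    let ?k' = "cyc_next n k"
    have eq: "cyc_tail n i k - {k} = cyc_tail n i ?k'"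
      using D empty cyc_tail_minus_self[OF i kn] by (simp split: if_splits)
    have k': "?k' \<in> {1..n}" using cyc_next_in[OF kn] .
    then have "?k' \<in> cyc_tail n i k - {k}" unfolding eq by (simp add: cyc_tail_def)
    then have "cyc_pos n i k \<le> cyc_pos n i ?k'" "?k' \<noteq> k" by (auto simp: cyc_tail_def)
    moreover have "cyc_pos n i ?k' \<le> cyc_pos n i k" using max[of ?k'] k' D eq by simp
    ultimately show False using inj_onD[OF inj_on_cyc_pos[OF i] _ k' kn] by simp
  qed
  then show ?thesis using k by (auto simp: jump_def)
qed

text \<open>The combinatorial half: the rank difference enters only through monotonicity, its
  extreme values and its link to the conecklaces.\<close>

lemma cyclic_shift_of_jumps:
  assumes ds: "decorated_permutation n (s, cs)" and dp: "decorated_permutation n (p, cp)"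
    and mono: "\<And>X Y. X \<subseteq> Y \<Longrightarrow> Y \<subseteq> {1..n} \<Longrightarrow> D X \<Longrightarrow> D Y"
    and full: "D {1..n}" and empty: "\<not> D {}"
    and sub: "\<And>i. i \<in> {1..n} \<Longrightarrow> perm_conecklace n (s, cs) i \<subseteq> perm_conecklace n (p, cp) i"
    and jump: "\<And>i k. i \<in> {1..n} \<Longrightarrow>
      k \<in> perm_conecklace n (p, cp) i - perm_conecklace n (s, cs) i \<longleftrightarrow> jump n D i k"
  shows "(s, cs) = cyclic_shift n ({1..n} - {k. \<exists>i\<in>{1..n}. jump n D i k}) (p, cp)"
proof -
  define U where "U = {k. \<exists>i\<in>{1..n}. jump n D i k}"
  have U: "U \<subseteq> {1..n}" by (auto simp: U_def jump_def)
  have perm_s: "s permutes {1..n}" and perm_p: "p permutes {1..n}"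
    and cs: "cs \<in> {1..n} \<rightarrow>\<^sub>E {0, 1, -1}" and cp: "cp \<in> {1..n} \<rightarrow>\<^sub>E {0, 1, -1}"
    and cs0: "\<And>x. x \<in> {1..n} \<Longrightarrow> cs x = 0 \<longleftrightarrow> s x \<noteq> x"
    and cp0: "\<And>x. x \<in> {1..n} \<Longrightarrow> cp x = 0 \<longleftrightarrow> p x \<noteq> x"
    using ds dp by (simp_all add: decorated_permutation_def)
  have sn: "\<And>x. x \<in> {1..n} \<Longrightarrow> s x \<in> {1..n}" and pn: "\<And>x. x \<in> {1..n} \<Longrightarrow> p x \<in> {1..n}"
    using permutes_in_image[OF perm_s] permutes_in_image[OF perm_p] by blast+
  note coloop_s = decorated_permutation_coloop[OF ds]
    and coloop_p = decorated_permutation_coloop[OF dp]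
  have uniq: "k = l" if "i \<in> {1..n}" "jump n D i k" "jump n D i l" for i k l
    by (rule jump_unique[OF _ that]) (rule mono)
  have notJ: "\<not> cyc_less n i (s k) k \<and> cs k \<noteq> -1" if "i \<in> {1..n}" "jump n D i k" for i k
    using jump[OF that(1), of k] that(2) by (auto simp: mem_perm_conecklace)
  have inJ: "cyc_less n i (p k) k \<or> cp k = -1" if "i \<in> {1..n}" "jump n D i k" for i k
    using jump[OF that(1), of k] that(2) by (auto simp: mem_perm_conecklace)
  have jumpI: "jump n D i k" if "i \<in> {1..n}" "k \<in> {1..n}" "cyc_less n i (p k) k \<or> cp k = -1"
    "\<not> cyc_less n i (s k) k" "cs k \<noteq> -1" for i k
    using jump[OF that(1), of k] that by (simp add: mem_perm_conecklace)

  have outside: "s k = p k \<and> cs k = cp k" if k: "k \<in> {1..n}" and "k \<notin> U" for k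
  proof -
    have eq: "cyc_less n i (s k) k \<or> cs k = -1 \<longleftrightarrow> cyc_less n i (p k) k \<or> cp k = -1"
      if i: "i \<in> {1..n}" for i
      using jump[OF i, of k] sub[OF i] \<open>k \<notin> U\<close> i k unfolding U_def
      by (auto simp: mem_perm_conecklace subset_iff)
    \<comment> \<open>Nothing precedes \<open>k\<close> in the order from \<open>k\<close>, so
      membership at \<open>i = k\<close> records exactly whether \<open>k\<close> is a
      coloop.\<close>
    have coloop: "cs k = -1 \<longleftrightarrow> cp k = -1"
      using eq[OF k] by (simp add: cyc_less_def cyc_pos_self[OF k])
    show ?thesis
    proof (cases "cs k = -1")
      case True
      then show ?thesis using coloop coloop_s[OF k] coloop_p[OF k] by simp
    next
      case False
      then have "s k = p k"
        using eq coloop cyc_less_determines[OF sn[OF k] pn[OF k] k] by simp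
      moreover have "cs k \<in> {0, 1, -1}" "cp k \<in> {0, 1, -1}"
        using PiE_mem[OF cs k] PiE_mem[OF cp k] .
      ultimately show ?thesis using False coloop cs0[OF k] cp0[OF k] by auto
    qed
  qed

  have inside: "s k = p (arg_max_on (cyc_pos n k) U) \<and> cs k = (if s k = k then 1 else 0)"
    if kU: "k \<in> U" for k
  proof -
    obtain j where j: "j \<in> {1..n}" "jump n D j k" using kU by (auto simp: U_def)
    have k: "k \<in> {1..n}" using kU U by blast
    \<comment> \<open>Plan: \<open>k\<close> is the jump just after \<open>i = s k\<close>, the jump
      \<open>l\<close> at \<open>i\<close> satisfies \<open>p l = i\<close>, and \<open>l\<close> is
      the last element of \<open>U\<close> in the order from \<open>k\<close>.\<close>
    define i where "i = s k"
    have i: "i \<in> {1..n}" using sn[OF k] by (simp add: i_def)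
    let ?i' = "cyc_next n i"
    have i': "?i' \<in> {1..n}" using cyc_next_in[OF i] .
    have csk: "cs k \<noteq> -1" and jki: "cyc_pos n j k \<le> cyc_pos n j i"
      using notJ[OF j] by (auto simp: cyc_less_def i_def)
    \<comment> \<open>In the order that starts after \<open>i\<close>, the value
      \<open>s k = i\<close> is last, hence not below \<open>k\<close>. That \<open>p k\<close> is
      below \<open>k\<close> carries over from \<open>j\<close>, because \<open>k\<close> does not
      come after \<open>i\<close> there.\<close>
    have jump_k: "jump n D ?i' k"
    proof (rule jumpI[OF i' k])
      show "cyc_less n ?i' (p k) k \<or> cp k = -1"
        using inJ[OF j] cyc_pos_next_less_trans[OF i j(1) pn[OF k] k _ jki]
        by (auto simp: cyc_less_def)
      show "\<not> cyc_less n ?i' (s k) k"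
        using cyc_pos_next_max[OF i k] by (simp add: cyc_less_def i_def[symmetric])
      show "cs k \<noteq> -1" using csk .
    qed
    obtain l where jump_l: "jump n D i l" using jump_exists[OF full empty i] by blast
    then have l: "l \<in> {1..n}" by (simp add: jump_def)
    have lU: "l \<in> U" using jump_l i by (auto simp: U_def)
    have coloop_i: "cp i = -1" if "l = i"
      using inJ[OF i jump_l] that by (auto simp: cyc_less_def cyc_pos_self[OF i])
    have lk_i: "l = i" if "l = k"
    proof -
      have "cyc_pos n i k \<le> cyc_pos n i i"
        using notJ[OF i jump_l] that by (simp add: cyc_less_def i_def[symmetric])
      then show ?thesis
        using that inj_onD[OF inj_on_cyc_pos[OF i] _ k i] by (simp add: cyc_pos_self[OF i])
    qed
    have pl: "p l = i"
    proof (cases "l = i")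
      case True
      then show ?thesis using coloop_i coloop_p[OF i] by simp
    next
      case False
      then have "l \<noteq> k" using lk_i by blast
      then have "s l \<noteq> i" using permutes_inj[OF perm_s] by (metis i_def injD)
      show ?thesis
      proof (rule ccontr)
        assume "p l \<noteq> i"
        \<comment> \<open>The orders from \<open>i\<close> and from its successor differ only in the
          place of \<open>i\<close>. Since none of \<open>l\<close>, \<open>p l\<close>,
          \<open>s l\<close> is \<open>i\<close>, the jump would stay at \<open>l\<close> although
          it is at \<open>k\<close>.\<close>
        have "jump n D ?i' l"
        proof (rule jumpI[OF i' l])
          show "cyc_less n ?i' (p l) l \<or> cp l = -1"
            using inJ[OF i jump_l] cyc_pos_next_less_iff[OF i pn[OF l] l \<open>p l \<noteq> i\<close> False]
            by (simp add: cyc_less_def)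
          show "\<not> cyc_less n ?i' (s l) l" "cs l \<noteq> -1"
            using notJ[OF i jump_l] cyc_pos_next_less_iff[OF i sn[OF l] l \<open>s l \<noteq> i\<close> False]
            by (simp_all add: cyc_less_def)
        qed
        then show False using uniq[OF i' jump_k] \<open>l \<noteq> k\<close> by blast
      qed
    qed
    have max: "cyc_pos n k u \<le> cyc_pos n k l" if uU: "u \<in> U" for u
    proof (rule ccontr)
      assume "\<not> ?thesis"
      then have lu: "cyc_pos n k l < cyc_pos n k u" by simp
      obtain j where j: "j \<in> {1..n}" "jump n D j u" using uU by (auto simp: U_def)
      have u: "u \<in> {1..n}" using uU U by blast
      show False
      proof (cases "l = k")
        case True
        \<comment> \<open>Now \<open>k\<close> is a loop for \<open>s\<close> and a coloop for
          \<open>p\<close>, so it is the jump for every start.\<close>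
        then have "s k = k" "cp k = -1" using lk_i coloop_i i_def by auto
        then have "jump n D j k"
          using csk by (intro jumpI[OF j(1) k]) (auto simp: cyc_less_def)
        then have "u = k" using uniq[OF j(1) j(2)] by blast
        then show False using lu True by simp
      next
        case False
        \<comment> \<open>The jump cannot move backwards: otherwise the tail of \<open>l\<close>, on
          which \<open>D\<close> holds, would lie strictly beyond \<open>k\<close> at the new start,
          where \<open>D\<close> fails.\<close>
        have "cyc_pos n ?i' l < cyc_pos n ?i' k" if li: "l \<noteq> i"
        proof (rule ccontr)
          assume "\<not> ?thesis"
          moreover have "cyc_pos n ?i' l \<noteq> cyc_pos n ?i' k"
            using False inj_onD[OF inj_on_cyc_pos[OF i'] _ l k] by blast
          ultimately have "cyc_tail n ?i' l \<subseteq> cyc_tail n ?i' k - {k}"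
            by (intro cyc_tail_subset_minus_self) simp
          then have "cyc_tail n i l \<subseteq> cyc_tail n ?i' k - {k}"
            using cyc_tail_next_superset[OF i l li] by simp
          moreover have "cyc_tail n ?i' k - {k} \<subseteq> {1..n}" using cyc_tail_subset by blast
          ultimately show False using mono jump_l jump_k unfolding jump_def by blast
        qed
        then have *: "cyc_pos n i l < cyc_pos n i u" "cyc_pos n ?i' u < cyc_pos n ?i' k"
          using cyc_pos_between[OF i k l u False lu] by blast+
        \<comment> \<open>The jump skips over \<open>u\<close>: \<open>D\<close> fails on the tail
          of \<open>u\<close> from \<open>i\<close>, but from the successor it holds even without
          \<open>u\<close>. Each arc beginning at \<open>u\<close> lies in the former tail or
          contains the latter, so \<open>u\<close> is never a jump.\<close>
        have D1: "\<not> D (cyc_tail n i u)"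
        proof
          assume "D (cyc_tail n i u)"
          moreover have "cyc_tail n i l - {l} \<subseteq> {1..n}" using cyc_tail_subset by blast
          ultimately have "D (cyc_tail n i l - {l})"
            using mono cyc_tail_subset_minus_self[OF *(1)] by blast
          then show False using jump_l by (simp add: jump_def)
        qed
        have "cyc_tail n ?i' u - {u} \<subseteq> {1..n}" using cyc_tail_subset by blast
        moreover have "D (cyc_tail n ?i' k)" using jump_k by (simp add: jump_def)
        ultimately have D2: "D (cyc_tail n ?i' u - {u})"
          using mono cyc_tail_subset_minus_self[OF *(2)] by blast
        have "u \<noteq> i" using *(2) cyc_pos_next_max[OF i k] by auto
        then consider "cyc_tail n j u \<subseteq> cyc_tail n i u" | "cyc_tail n ?i' u \<subseteq> cyc_tail n j u"
          using cyc_tail_comparable[OF i j(1) u] by blast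
        then show False
        proof cases
          case 1
          then show False using mono[OF 1 cyc_tail_subset] j(2) D1 by (simp add: jump_def)
        next
          case 2
          then have "cyc_tail n ?i' u - {u} \<subseteq> cyc_tail n j u - {u}" by blast
          moreover have "cyc_tail n j u - {u} \<subseteq> {1..n}" using cyc_tail_subset by blast
          ultimately have "D (cyc_tail n j u - {u})" using mono D2 by blast
          then show False using j(2) by (simp add: jump_def)
        qed
      qed
    qed
    have "arg_max_on (cyc_pos n k) U = l"
      unfolding arg_max_on_def arg_max_def is_arg_max_def
    proof (rule some_equality)
      show "l \<in> U \<and> \<not> (\<exists>y. y \<in> U \<and> cyc_pos n k l < cyc_pos n k y)"
        using lU max by (auto simp: not_less)
      show "x = l" if x: "x \<in> U \<and> \<not> (\<exists>y. y \<in> U \<and> cyc_pos n k x < cyc_pos n k y)" for x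
      proof (rule inj_onD[OF inj_on_cyc_pos[OF k]])
        show "cyc_pos n k x = cyc_pos n k l" using x lU max[of x] by (meson le_antisym not_less)
        show "x \<in> {1..n}" "l \<in> {1..n}" using x U l by blast+
      qed
    qed
    moreover have "cs k = (if s k = k then 1 else 0)"
      using PiE_mem[OF cs k] csk cs0[OF k] by auto
    ultimately show ?thesis using pl by (simp add: i_def)
  qed

  have UA: "{1..n} - ({1..n} - U) = U" using U by blast
  \<comment> \<open>Equality is needed on all naturals: outside \<open>{1..n}\<close> both
    permutations are the identity and both colourings are \<open>undefined\<close>.\<close>
  have mapeq: "s = (\<lambda>i. if i \<in> U then p (arg_max_on (cyc_pos n i) U) else p i)"
  proof
    fix i
    show "s i = (if i \<in> U then p (arg_max_on (cyc_pos n i) U) else p i)"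
      using inside[of i] outside[of i] permutes_not_in[OF perm_s, of i]
        permutes_not_in[OF perm_p, of i] by (cases "i \<in> {1..n}") auto
  qed
  have coleq: "cs = (\<lambda>i\<in>{1..n}. if i \<in> {1..n} - U then cp i else if s i = i then 1 else 0)"
  proof
    fix i
    show "cs i = (\<lambda>i\<in>{1..n}. if i \<in> {1..n} - U then cp i else if s i = i then 1 else 0) i"
      using inside[of i] outside[of i] PiE_arb[OF cs, of i] by (cases "i \<in> {1..n}") auto
  qed
  show ?thesis
    unfolding cyclic_shift_def prod.case U_def[symmetric] UA mapeq[symmetric]
    unfolding Let_def coleq[symmetric] ..
qed

theorem theorem3p4:
  fixes n :: nat and M N :: "nat set set" and \<sigma> \<pi> :: decperm and A :: "nat set"
  assumes "positroid n M" and "positroid n N"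
    and "quotient_of {1..n} M N"
    and "int (rk M) = int (rk N) - 1"
    and "decorated_permutation_of n M \<sigma>" and "decorated_permutation_of n N \<pi>"
    and "A = {1..n} - (\<Union>i\<in>{1..n}. (conecklace n N i - conecklace n M i))"
  shows "\<sigma> = cyclic_shift n A \<pi>"
proof -
  obtain s cs p cp where [simp]: "\<sigma> = (s, cs)" "\<pi> = (p, cp)" by (cases \<sigma>, cases \<pi>)
  have ds: "decorated_permutation n \<sigma>" and M: "M = positroid_bases n \<sigma>"
    and dp: "decorated_permutation n \<pi>" and N: "N = positroid_bases n \<pi>"
    using assms(5,6) by (simp_all add: decorated_permutation_of_def)
  have mM: "matroid {1..n} M" and mN: "matroid {1..n} N"
    using assms(1,2) by (simp_all add: positroid_def)
  have ne: "M \<noteq> {}" "N \<noteq> {}" using mM mN by (simp_all add: matroid_def)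
  define D where "D X \<longleftrightarrow> mrank N X = Suc (mrank M X)" for X
  have diff: "mrank M Y + mrank N X \<le> mrank N Y + mrank M X" if "X \<subseteq> Y" "Y \<subseteq> {1..n}" for X Y
    using quotient_mrank_diff_mono[OF mM finite_atLeastAtMost ne(2) assms(3) that] .
  have ground: "mrank N {1..n} = Suc (mrank M {1..n})"
    using assms(4) mrank_ground[OF mM] mrank_ground[OF mN] by simp
  \<comment> \<open>Comparing with the empty set and with the ground set confines the rank
    difference to 0 and 1.\<close>
  have lower: "mrank M X \<le> mrank N X" if "X \<subseteq> {1..n}" for X
    using diff[OF empty_subsetI that] mrank_empty[OF ne(1)] mrank_empty[OF ne(2)] by simp
  have upper: "mrank N X \<le> Suc (mrank M X)" if "X \<subseteq> {1..n}" for X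
    using diff[OF that subset_refl] ground by simp
  have mono: "D Y" if "X \<subseteq> Y" "Y \<subseteq> {1..n}" "D X" for X Y
    using diff[OF that(1,2)] upper[OF that(2)] that(3) by (simp add: D_def)
  \<comment> \<open>Membership of \<open>k\<close> in a conecklace is a rank drop of one.
    Subtracting the drop in \<open>M\<close> from that in \<open>N\<close> gives the change of the
    rank difference, which is 0 or 1.\<close>
  have tails: "k \<in> perm_conecklace n \<sigma> i \<Longrightarrow> k \<in> perm_conecklace n \<pi> i"
    "k \<in> perm_conecklace n \<pi> i \<and> k \<notin> perm_conecklace n \<sigma> i \<longleftrightarrow>
      D (cyc_tail n i k) \<and> \<not> D (cyc_tail n i k - {k})"
    if i: "i \<in> {1..n}" and k: "k \<in> {1..n}" for i k
  proof -
    let ?T = "cyc_tail n i k"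
    have sub: "?T \<subseteq> {1..n}" "?T - {k} \<subseteq> {1..n}" using cyc_tail_subset by blast+
    note mrank_cyc_tail_minus_self[OF ds i k, folded M]
      mrank_cyc_tail_minus_self[OF dp i k, folded N]
      diff[OF Diff_subset sub(1), of "{k}"] upper[OF sub(1)] lower[OF sub(2)]
    then show "k \<in> perm_conecklace n \<sigma> i \<Longrightarrow> k \<in> perm_conecklace n \<pi> i"
      "k \<in> perm_conecklace n \<pi> i \<and> k \<notin> perm_conecklace n \<sigma> i \<longleftrightarrow> D ?T \<and> \<not> D (?T - {k})"
      unfolding D_def by (simp_all split: if_splits)
  qed
  have jump: "k \<in> perm_conecklace n \<pi> i - perm_conecklace n \<sigma> i \<longleftrightarrow> jump n D i k"
    if i: "i \<in> {1..n}" for i k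
    using tails(2)[OF i, of k] perm_conecklace_subset[of n \<pi> i] unfolding jump_def by blast
  have sub: "perm_conecklace n \<sigma> i \<subseteq> perm_conecklace n \<pi> i" if i: "i \<in> {1..n}" for i
    using tails(1)[OF i] perm_conecklace_subset[of n \<sigma> i] by blast
  have full: "D {1..n}" using ground by (simp add: D_def)
  have empty: "\<not> D {}" using mrank_empty[OF ne(1)] mrank_empty[OF ne(2)] by (simp add: D_def)
  have "conecklace n N i - conecklace n M i = {k. jump n D i k}" if i: "i \<in> {1..n}" for i
    unfolding M N conecklace_positroid_bases[OF ds i] conecklace_positroid_bases[OF dp i]
    using jump[OF i] by blast
  then have "A = {1..n} - {k. \<exists>i\<in>{1..n}. jump n D i k}" unfolding assms(7) by auto
  moreover have "(s, cs) = cyclic_shift n ({1..n} - {k. \<exists>i\<in>{1..n}. jump n D i k}) (p, cp)"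
    using cyclic_shift_of_jumps[of n s cs p cp D] ds dp mono full empty sub jump by simp
  ultimately show ?thesis by simp
qed

end
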